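(* Let $\mathfrak{g}_0$ be a vector space over a field $\Bbbk$ with linear basis $X=\{f_i\mid i\in I\}$, where $I$ is a well-ordered set, regarded as an algebra with two zero Lie brackets, and let $X'=\{F_i\mid i\in I\}$ be a set disjoint from $X$ with $F_i:=f_i'$. Let $$U_{\mathrm{Lie}_2}(\mathfrak{g}_0)=\mathrm{As}\langle X\cup X'\mid f_if_j-f_jf_i,\ F_iF_j-F_jF_i,\ f_iF_j-F_jf_i+F_if_j-f_jF_i\ \ (i,j\in I)\rangle .$$ Order $X\cup X'$ by: $f_i<f_j$ if $i<j$; $F_j<F_i$ if $i<j$; $f_i<F_j$ for all $i,j\in I$; and order the words in the alphabet $X\cup X'$ by the corresponding deg-lex ordering. Then the set of all the elements \begin{gather*} f_j f_i - f_i f_j,\quad i<j,\\ F_i F_j - F_j F_i,\quad i<j,\\ F_i w f_k - f_k F_i w - F_k w f_i + f_i F_k w,\quad w\leq i<k, \end{gather*} where $i,j,k\in I$ and where $w=1$ or $w=f_{s_1}\cdots f_{s_t}$ with $s_1\leq\dots\leq s_t$, forms a Gröbner–Shirshov basis for $U_{\mathrm{Lie}_2}(\mathfrak{g}_0)$.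
   Context: $\mathrm{As}(Y)$ denotes the free associative (unital) $\Bbbk$-algebra on a set $Y$, $Y^*$ the set of all words in the alphabet $Y$ (including the empty word $1$), and $\mathrm{As}\langle Y\mid R\rangle$ the quotient of $\mathrm{As}(Y)$ by the two-sided ideal generated by $R$. For $w=f_{s_1}\cdots f_{s_t}$ with $s_1\le\dots\le s_t$, the notation $w\le i$ means $s_t\le i$; the condition is vacuous for $w=1$. Monomial orderings: let $(Y,<)$ be a well-ordered set and suppose that $Y^*$ is well-ordered in such a way that $u<v$ implies $w_1uw_2<w_1vw_2$ for all $w_1,w_2\in Y^*$; such an ordering is called monomial. The ordering used is the deg-lex ordering, in which two words are compared first by degree (length) and then lexicographically. For nonzero $f\in \mathrm{As}(Y)$, $\bar f$ denotes its leading word; $f$ is monic if the coefficient of $\bar f$ is $1$. $|u|$ denotes the length of a word $u$. Compositions of monic $f,g$ with respect to a monomial ordering: (i) if $v$ is a word with $v=\bar f b=a\bar g$ for some $a,b\in Y^*$ and $|\bar f|+|\bar g|>|v|$, then $(f,g)_v:=fb-ag$ is the intersection composition of $f$ and $g$ with respect to $v$; (ii) if $v=\bar f=a\bar g b$ for some $a,b\in Y^*$, then $(f,g)_v:=f-agb$ is the inclusion composition of $f$ and $g$ with respect to $v$. Let $S\subset\mathrm{As}(Y)$ be a set of monic elements. An element $h\in\mathrm{As}(Y)$ is trivial modulo $(S,v)$ if $h=\sum_i\alpha_i a_is_ib_i$ with $\alpha_i\in\Bbbk$, $a_i,b_i\in Y^*$, $s_i\in S$ and $a_i\bar{s}_ib_i<v$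 for all $i$. A monic set $S\subset\mathrm{As}(Y)$ is called a Gröbner–Shirshov basis in $\mathrm{As}(Y)$ with respect to the monomial ordering $<$ if every composition of elements of $S$ is trivial modulo $S$ and the corresponding word $v$. It is a Gröbner–Shirshov basis for an algebra $\mathrm{As}\langle Y\mid R\rangle$ if, in addition, $S$ generates the same two-sided ideal of $\mathrm{As}(Y)$ as $R$.
   Formalization: The monomial ordering is not required to be a well-ordering: for infinite I the given order has the descending chain F_0 > F_1 > ..., so only a strict total order compatible with multiplication is demanded; for finite I the deg-lex ordering is a well-ordering. *)

theory Defs
  imports Complex_Main "HOL-Library.Poly_Mapping"
begin

text \<open>
  Words form the monoid of lists under concatenation. The free associative unital algebra is the
  monoid algebra \<^typ>\<open>'y list \<Rightarrow>\<^sub>0 'k\<close>: the convolution product of \<^theory>\<open>HOL-Library.Poly_Mapping\<close>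
  only needs the monoid of keys written additively.
\<close>

instantiation list :: (type) monoid_add
begin
definition zero_list :: "'a list" where "zero_list = []"
definition plus_list :: "'a list \<Rightarrow> 'a list \<Rightarrow> 'a list" where "plus_list u v = u @ v"
instance by standard (simp_all add: zero_list_def plus_list_def)
end

definition As :: "'y set \<Rightarrow> ('y list \<Rightarrow>\<^sub>0 'k::field) set" where
  "As Y = {p. Poly_Mapping.keys p \<subseteq> lists Y}"

abbreviation monom :: "'k::field \<Rightarrow> 'y list \<Rightarrow> ('y list \<Rightarrow>\<^sub>0 'k)" where
  "monom c w \<equiv> Poly_Mapping.single w c"

abbreviation word :: "'y list \<Rightarrow> ('y list \<Rightarrow>\<^sub>0 'k::field)" where
  "word w \<equiv> monom 1 w"

definition two_sided_ideal :: "'y set \<Rightarrow> ('y list \<Rightarrow>\<^sub>0 'k::field) set \<Rightarrow> bool" where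
  "two_sided_ideal Y J \<longleftrightarrow> J \<subseteq> As Y \<and> 0 \<in> J \<and> (\<forall>p\<in>J. \<forall>q\<in>J. p + q \<in> J)
     \<and> (\<forall>p\<in>J. \<forall>a\<in>As Y. a * p \<in> J \<and> p * a \<in> J)"

definition ideal_generated :: "'y set \<Rightarrow> ('y list \<Rightarrow>\<^sub>0 'k::field) set \<Rightarrow> ('y list \<Rightarrow>\<^sub>0 'k) set" where
  "ideal_generated Y R = \<Inter>{J. two_sided_ideal Y J \<and> R \<subseteq> J}"

text \<open>
  A strict ordering of words is given by the relation \<open>lt\<close> of all pairs \<open>(u, v)\<close> with \<open>u < v\<close>.
  Well-foundedness is kept apart from the other requirements on a monomial ordering: leading words,
  compositions and triviality do not use it, and the ordering \<open>deglex\<close> below is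
  well-founded only for finite \<open>I\<close>, since the letters \<open>F\<^sub>i\<close> are ordered oppositely to \<open>I\<close>
  (see \<open>deglex_monomial_iff_finite\<close>).
\<close>

definition word_ordering :: "'y set \<Rightarrow> 'y list rel \<Rightarrow> bool" where
  "word_ordering Y lt \<longleftrightarrow> irrefl_on (lists Y) lt \<and> trans_on (lists Y) lt \<and> total_on (lists Y) lt
     \<and> (\<forall>u\<in>lists Y. \<forall>v\<in>lists Y. \<forall>w1\<in>lists Y. \<forall>w2\<in>lists Y.
          (u, v) \<in> lt \<longrightarrow> (w1 @ u @ w2, w1 @ v @ w2) \<in> lt)"

definition monomial_ordering :: "'y set \<Rightarrow> 'y list rel \<Rightarrow> bool" where
  "monomial_ordering Y lt \<longleftrightarrow> word_ordering Y lt \<and> wf (Restr lt (lists Y))"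

definition lead :: "'y list rel \<Rightarrow> ('y list \<Rightarrow>\<^sub>0 'k::field) \<Rightarrow> 'y list" where
  "lead lt p = (THE w. w \<in> Poly_Mapping.keys p \<and> (\<forall>u\<in>Poly_Mapping.keys p. u \<noteq> w \<longrightarrow> (u, w) \<in> lt))"

definition monic :: "'y list rel \<Rightarrow> ('y list \<Rightarrow>\<^sub>0 'k::field) \<Rightarrow> bool" where
  "monic lt p \<longleftrightarrow> p \<noteq> 0 \<and> Poly_Mapping.lookup p (lead lt p) = 1"

definition intersection_composition ::
  "'y set \<Rightarrow> 'y list rel \<Rightarrow> ('y list \<Rightarrow>\<^sub>0 'k::field) \<Rightarrow> ('y list \<Rightarrow>\<^sub>0 'k) \<Rightarrow> 'y list \<Rightarrow> ('y list \<Rightarrow>\<^sub>0 'k) \<Rightarrow> bool" where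
  "intersection_composition Y lt f g v h \<longleftrightarrow>
     (\<exists>a\<in>lists Y. \<exists>b\<in>lists Y. v = lead lt f @ b \<and> v = a @ lead lt g
        \<and> length (lead lt f) + length (lead lt g) > length v
        \<and> h = f * word b - word a * g)"

definition inclusion_composition ::
  "'y set \<Rightarrow> 'y list rel \<Rightarrow> ('y list \<Rightarrow>\<^sub>0 'k::field) \<Rightarrow> ('y list \<Rightarrow>\<^sub>0 'k) \<Rightarrow> 'y list \<Rightarrow> ('y list \<Rightarrow>\<^sub>0 'k) \<Rightarrow> bool" where
  "inclusion_composition Y lt f g v h \<longleftrightarrow>
     (\<exists>a\<in>lists Y. \<exists>b\<in>lists Y. v = lead lt f \<and> v = a @ lead lt g @ b
        \<and> h = f - word a * g * word b)"

definition trivial_modulo ::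
  "'y set \<Rightarrow> 'y list rel \<Rightarrow> ('y list \<Rightarrow>\<^sub>0 'k::field) set \<Rightarrow> 'y list \<Rightarrow> ('y list \<Rightarrow>\<^sub>0 'k) \<Rightarrow> bool" where
  "trivial_modulo Y lt S v h \<longleftrightarrow>
     (\<exists>(n::nat) \<alpha> a s b.
        (\<forall>i<n. a i \<in> lists Y \<and> b i \<in> lists Y \<and> s i \<in> S \<and> (a i @ lead lt (s i) @ b i, v) \<in> lt)
        \<and> h = (\<Sum>i<n. monom (\<alpha> i) (a i) * s i * word (b i)))"

definition GS_basis :: "'y set \<Rightarrow> 'y list rel \<Rightarrow> ('y list \<Rightarrow>\<^sub>0 'k::field) set \<Rightarrow> bool" where
  "GS_basis Y lt S \<longleftrightarrow> word_ordering Y lt \<and> S \<subseteq> As Y \<and> (\<forall>s\<in>S. monic lt s)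
     \<and> (\<forall>f\<in>S. \<forall>g\<in>S. \<forall>v h. intersection_composition Y lt f g v h \<or> inclusion_composition Y lt f g v h
          \<longrightarrow> trivial_modulo Y lt S v h)"

text \<open>Groebner--Shirshov basis for the algebra with generators \<open>Y\<close> and relators \<open>R\<close>.\<close>

definition GS_basis_for ::
  "'y set \<Rightarrow> 'y list rel \<Rightarrow> ('y list \<Rightarrow>\<^sub>0 'k::field) set \<Rightarrow> ('y list \<Rightarrow>\<^sub>0 'k) set \<Rightarrow> bool" where
  "GS_basis_for Y lt R S \<longleftrightarrow> GS_basis Y lt S \<and> ideal_generated Y S = ideal_generated Y R"

text \<open>The letters: \<open>Lf i\<close> stands for \<open>f\<^sub>i\<close> and \<open>LF i\<close> for \<open>F\<^sub>i\<close>.\<close>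

datatype 'i letter = Lf 'i | LF 'i

definition letters :: "'i set \<Rightarrow> 'i letter set" where
  "letters I = Lf ` I \<union> LF ` I"

definition letter_less :: "'i::wellorder letter rel" where
  "letter_less = {(Lf i, Lf j) | i j. i < j} \<union> {(LF j, LF i) | i j. i < j} \<union> {(Lf i, LF j) | i j. True}"

definition deglex :: "'i::wellorder letter list rel" where
  "deglex = lenlex letter_less"

definition gen_f :: "'i \<Rightarrow> ('i letter list \<Rightarrow>\<^sub>0 'k::field)" where
  "gen_f i = word [Lf i]"

definition gen_F :: "'i \<Rightarrow> ('i letter list \<Rightarrow>\<^sub>0 'k::field)" where
  "gen_F i = word [LF i]"

definition gen_fs :: "'i list \<Rightarrow> ('i letter list \<Rightarrow>\<^sub>0 'k::field)" where
  "gen_fs ss = word (map Lf ss)"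

definition U_Lie2_relators :: "'i set \<Rightarrow> ('i letter list \<Rightarrow>\<^sub>0 'k::field) set" where
  "U_Lie2_relators I =
     {gen_f i * gen_f j - gen_f j * gen_f i | i j. i \<in> I \<and> j \<in> I}
   \<union> {gen_F i * gen_F j - gen_F j * gen_F i | i j. i \<in> I \<and> j \<in> I}
   \<union> {gen_f i * gen_F j - gen_F j * gen_f i + gen_F i * gen_f j - gen_f j * gen_F i | i j. i \<in> I \<and> j \<in> I}"

definition U_Lie2_GS :: "'i::wellorder set \<Rightarrow> ('i letter list \<Rightarrow>\<^sub>0 'k::field) set" where
  "U_Lie2_GS I =
     {gen_f j * gen_f i - gen_f i * gen_f j | i j. i \<in> I \<and> j \<in> I \<and> i < j}
   \<union> {gen_F i * gen_F j - gen_F j * gen_F i | i j. i \<in> I \<and> j \<in> I \<and> i < j}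
   \<union> {gen_F i * gen_fs ss * gen_f k - gen_f k * gen_F i * gen_fs ss - gen_F k * gen_fs ss * gen_f i + gen_f i * gen_F k * gen_fs ss | i k ss.
        i \<in> I \<and> k \<in> I \<and> set ss \<subseteq> I \<and> sorted ss \<and> (ss \<noteq> [] \<longrightarrow> last ss \<le> i) \<and> i < k}"

lemma deglex_word_ordering: "word_ordering Y deglex"
proof -
  have ir: "irrefl (letter_less :: 'a letter rel)"
    by (auto simp: irrefl_def letter_less_def)
  have tr: "trans (letter_less :: 'a letter rel)"
    by (rule transI) (auto simp: letter_less_def)
  have to: "total (letter_less :: 'a letter rel)"
  proof (rule totalI)
    fix x y :: "'a letter" assume "x \<noteq> y"
    then show "(x, y) \<in> letter_less \<or> (y, x) \<in> letter_less"
      by (cases x; cases y) (auto simp: letter_less_def)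
  qed
  have irl: "(u, u) \<notin> lenlex (letter_less :: 'a letter rel)" for u
    using ir by (simp add: lenlex_irreflexive irrefl_def)
  have pre: "(w @ u, w @ v) \<in> lenlex letter_less" if "(u, v) \<in> lenlex (letter_less :: 'a letter rel)" for u v w
    using that by (induction w) (auto simp: Cons_lenlex_iff)
  have post: "(u @ w, v @ w) \<in> lenlex letter_less" if "(u, v) \<in> lenlex (letter_less :: 'a letter rel)" for u v w
    using that by (auto simp: lenlex_conv lex_append_rightI)
  show ?thesis
    unfolding word_ordering_def deglex_def
    using irl lenlex_trans[OF _ _ tr] total_lenlex[OF to] pre post
    by (auto simp: irrefl_on_def trans_on_def total_on_def)
qed

lemma deglex_monomial_iff_finite:
  fixes I :: "'a::wellorder set"
  shows "monomial_ordering (letters I) deglex \<longleftrightarrow> finite I"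
proof
  assume "finite I"
  define r where "r = Restr (letter_less :: 'a letter rel) (letters I)"
  have "finite r"
    using \<open>finite I\<close> by (simp add: r_def letters_def)
  moreover have "acyclic r"
  proof -
    have "trans r" unfolding trans_def by (auto simp: letter_less_def r_def)
    moreover have "irrefl r" by (auto simp: letter_less_def r_def irrefl_def)
    ultimately show ?thesis by (simp add: acyclic_irrefl)
  qed
  ultimately have "wf r" by (rule finite_acyclic_wf)
  then have "wf (lenlex r)" by (rule wf_lenlex)
  moreover have "Restr deglex (lists (letters I)) \<subseteq> lenlex r"
  proof (rule subrelI)
    fix u v :: "'a letter list"
    assume "(u, v) \<in> Restr deglex (lists (letters I))"
    then have "(u, v) \<in> lenlex letter_less" "set u \<subseteq> letters I" "set v \<subseteq> letters I"
      by (auto simp: deglex_def)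
    then show "(u, v) \<in> lenlex r"
    proof (induction u arbitrary: v)
      case Nil
      then show ?case by simp
    next
      case (Cons x u)
      then obtain y v' where "v = y # v'" by (cases v) auto
      with Cons show ?case by (auto simp: Cons_lenlex_iff r_def)
    qed
  qed
  ultimately have "wf (Restr deglex (lists (letters I)))" by (rule wf_subset)
  then show "monomial_ordering (letters I) deglex"
    by (simp add: monomial_ordering_def deglex_word_ordering)
next
  assume m: "monomial_ordering (letters I) deglex"
  show "finite I"
  proof (rule ccontr)
    assume inf: "infinite I"
    define J where "J = {i \<in> I. finite {j \<in> I. j < i}}"
    have infJ: "infinite J"
    proof
      assume fin: "finite J"
      with inf have "\<exists>i. i \<in> I - J" by (metis J_def finite_subset subsetI DiffI)
      then have mem: "(LEAST i. i \<in> I - J) \<in> I - J" by (rule LeastI_ex)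
      have "{j \<in> I. j < (LEAST i. i \<in> I - J)} \<subseteq> J" using not_less_Least by blast
      with fin mem show False by (auto simp: J_def dest: finite_subset)
    qed
    have up: "\<exists>j\<in>J. i < j" if "i \<in> J" for i
    proof (rule ccontr)
      assume "\<not> (\<exists>j\<in>J. i < j)"
      then have "J \<subseteq> insert i {j \<in> I. j < i}" by (auto simp: J_def)
      with that infJ show False by (auto simp: J_def dest: finite_subset)
    qed
    obtain i0 where i0: "i0 \<in> J" using infJ by fastforce
    have wf: "wf (Restr deglex (lists (letters I)))" using m by (simp add: monomial_ordering_def)
    define Q where "Q = {[LF i] | i. i \<in> J}"
    have "[LF i0] \<in> Q" using i0 by (auto simp: Q_def)
    then obtain z where z: "z \<in> Q" "\<And>y. (y, z) \<in> Restr deglex (lists (letters I)) \<Longrightarrow> y \<notin> Q"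
      by (rule wfE_min[OF wf]) simp
    then obtain i where i: "i \<in> J" "z = [LF i]" by (auto simp: Q_def)
    with up obtain j where "j \<in> J" "i < j" by blast
    then have "([LF j], z) \<in> Restr deglex (lists (letters I))"
      using i by (auto simp: deglex_def Cons_lenlex_iff letter_less_def letters_def J_def)
    then have "[LF j] \<notin> Q" by (rule z(2))
    with \<open>j \<in> J\<close> show False by (auto simp: Q_def)
  qed
qed

end

theory Submission
  imports Defs "HOL-Library.Multiset"
begin

text \<open>
  Write \<open>c(i,w,k) = F\<^sub>i w f\<^sub>k - f\<^sub>k F\<^sub>i w - F\<^sub>k w f\<^sub>i + f\<^sub>i F\<^sub>k w\<close>. Up to commuting the letters \<open>f\<close>, \<open>c(i,w,k)\<close>
  equals \<open>c(i,1,k) w\<close>, so both sets generate the same ideal. For compositions, no leading word is a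
  proper subword of another, and proper overlaps occur only on \<open>f\<^sub>k f\<^sub>j f\<^sub>i\<close>, \<open>F\<^sub>i F\<^sub>j F\<^sub>k\<close>,
  \<open>F\<^sub>i F\<^sub>j w f\<^sub>k\<close> and \<open>F\<^sub>i w f\<^sub>k f\<^sub>j\<close>. Behind a first letter smaller than that of the overlap word every
  homogeneous relation of the right degree may be used freely, so \<open>c(i,w,k)\<close> is available there for
  all \<open>w\<close>; the few remaining terms reduce by elements of the basis itself.
\<close>

section \<open>Words and leading words for deg-lex\<close>

lemma word_mult: "(word u :: 'y list \<Rightarrow>\<^sub>0 'k::field) * word v = word (u @ v)"
  by (simp add: Poly_Mapping.mult_single plus_list_def)

lemma word_Nil: "(word [] :: 'y list \<Rightarrow>\<^sub>0 'k::field) = 1"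
  by (simp flip: zero_list_def)

lemma deglex_irrefl: "(u, u) \<notin> deglex"
  using deglex_word_ordering[of UNIV] by (auto simp: word_ordering_def irrefl_on_def)

lemma deglex_trans: "(u, v) \<in> deglex \<Longrightarrow> (v, w) \<in> deglex \<Longrightarrow> (u, w) \<in> deglex"
  using deglex_word_ordering[of UNIV] by (auto simp: word_ordering_def trans_on_def)

lemma deglex_append:
  "(u, v) \<in> deglex \<Longrightarrow> (w1 @ u @ w2, w1 @ v @ w2) \<in> deglex"
  using deglex_word_ordering[of UNIV] unfolding word_ordering_def by fastforce

lemma deglex_Cons:
  "length u = length v \<Longrightarrow> (x, y) \<in> letter_less \<Longrightarrow> (x # u, y # v) \<in> deglex"
  by (simp add: deglex_def Cons_lenlex_iff)

text \<open>By irreflexivity \<open>w\<close> does not occur in \<open>q\<close>, so its coefficient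
  1 survives. The basis elements are put into this form, \<open>q\<close> collecting the lower
  terms.\<close>

lemma lead_monic_minus:
  fixes q :: "'i::wellorder letter list \<Rightarrow>\<^sub>0 'k::field"
  assumes q: "\<And>u. u \<in> Poly_Mapping.keys q \<Longrightarrow> (u, w) \<in> deglex"
  shows "lead deglex (word w - q) = w" and "monic deglex (word w - q)"
proof -
  let ?p = "word w - q"
  have "w \<notin> Poly_Mapping.keys q"
    using q deglex_irrefl by blast
  then have one: "Poly_Mapping.lookup ?p w = 1"
    by (simp add: lookup_minus in_keys_iff)
  then have w: "w \<in> Poly_Mapping.keys ?p"
    by (simp add: in_keys_iff)
  have less: "(u, w) \<in> deglex" if "u \<in> Poly_Mapping.keys ?p" "u \<noteq> w" for u
    using that q keys_diff[of "word w :: _ \<Rightarrow>\<^sub>0 'k" q] by (auto split: if_splits)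
  show lead: "lead deglex ?p = w"
    unfolding lead_def
  proof (rule the_equality)
    fix u assume "u \<in> Poly_Mapping.keys ?p \<and> (\<forall>v\<in>Poly_Mapping.keys ?p. v \<noteq> u \<longrightarrow> (v, u) \<in> deglex)"
    with w less show "u = w"
      using deglex_trans deglex_irrefl by metis
  qed (use w less in blast)
  show "monic deglex ?p"
    using w one by (auto simp: monic_def lead)
qed

section \<open>Triviality as a linear condition\<close>

lemma trivial_modulo_0: "trivial_modulo Y lt S v 0"
  unfolding trivial_modulo_def by (rule exI[of _ 0]) simp

lemma trivial_modulo_add_term:
  assumes "trivial_modulo Y lt S v h" "a \<in> lists Y" "b \<in> lists Y" "s \<in> S"
    "(a @ lead lt s @ b, v) \<in> lt"
  shows "trivial_modulo Y lt S v (h + monom c a * s * word b)"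
proof -
  from assms(1) obtain n \<alpha> a' s' b' where
    *: "\<forall>i<n. a' i \<in> lists Y \<and> b' i \<in> lists Y \<and> s' i \<in> S \<and> (a' i @ lead lt (s' i) @ b' i, v) \<in> lt"
       "h = (\<Sum>i<n::nat. monom (\<alpha> i) (a' i) * s' i * word (b' i))"
    unfolding trivial_modulo_def by blast
  show ?thesis
    unfolding trivial_modulo_def
    by (rule exI[of _ "Suc n"], rule exI[of _ "\<alpha>(n := c)"], rule exI[of _ "a'(n := a)"],
        rule exI[of _ "s'(n := s)"], rule exI[of _ "b'(n := b)"])
       (use * assms in \<open>auto simp: less_Suc_eq\<close>)
qed

lemma trivial_modulo_term:
  assumes "a \<in> lists Y" "b \<in> lists Y" "s \<in> S" "(a @ lead lt s @ b, v) \<in> lt"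
  shows "trivial_modulo Y lt S v (word a * s * word b)"
  using trivial_modulo_add_term[OF trivial_modulo_0 assms, of 1] by simp

lemma trivial_modulo_add:
  assumes "trivial_modulo Y lt S v g" "trivial_modulo Y lt S v h"
  shows "trivial_modulo Y lt S v (g + h)"
proof -
  from assms(2) obtain n \<alpha> a s b where
    *: "\<forall>i<n. a i \<in> lists Y \<and> b i \<in> lists Y \<and> s i \<in> S \<and> (a i @ lead lt (s i) @ b i, v) \<in> lt"
       "h = (\<Sum>i<n::nat. monom (\<alpha> i) (a i) * s i * word (b i))"
    unfolding trivial_modulo_def by blast
  have "trivial_modulo Y lt S v (g + (\<Sum>i<m. monom (\<alpha> i) (a i) * s i * word (b i)))" if "m \<le> n" for m
    using that
  proof (induction m)
    case (Suc m)
    then show ?case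
      using trivial_modulo_add_term[OF Suc.IH, of "a m" "b m" "s m" "\<alpha> m"] *(1)
      by (simp add: add.assoc)
  qed (use assms(1) in simp)
  then show ?thesis using * by simp
qed

lemma trivial_modulo_uminus:
  assumes "trivial_modulo Y lt S v h"
  shows "trivial_modulo Y lt S v (- h)"
proof -
  from assms obtain n \<alpha> a s b where
    *: "\<forall>i<n. a i \<in> lists Y \<and> b i \<in> lists Y \<and> s i \<in> S \<and> (a i @ lead lt (s i) @ b i, v) \<in> lt"
       "h = (\<Sum>i<n::nat. monom (\<alpha> i) (a i) * s i * word (b i))"
    unfolding trivial_modulo_def by blast
  then show ?thesis
    unfolding trivial_modulo_def
    by (intro exI[of _ n] exI[of _ "\<lambda>i. - \<alpha> i"] exI[of _ a] exI[of _ s] exI[of _ b])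
       (simp add: single_uminus sum_negf)
qed

lemma trivial_modulo_diff:
  assumes "trivial_modulo Y lt S v g" "trivial_modulo Y lt S v h"
  shows "trivial_modulo Y lt S v (g - h)"
  using trivial_modulo_add[OF assms(1) trivial_modulo_uminus[OF assms(2)]] by simp

section \<open>Basis elements and their leading words\<close>

lemma Lf_in_letters [simp]: "Lf x \<in> letters I \<longleftrightarrow> x \<in> I"
  by (auto simp: letters_def)

lemma LF_in_letters [simp]: "LF x \<in> letters I \<longleftrightarrow> x \<in> I"
  by (auto simp: letters_def)

lemma map_Lf_in_lists [simp]: "map Lf ss \<in> lists (letters I) \<longleftrightarrow> set ss \<subseteq> I"
  by (induction ss) auto

lemma Lf_less_Lf [simp]: "(Lf i, Lf j) \<in> letter_less \<longleftrightarrow> i < j"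
  by (auto simp: letter_less_def)

lemma LF_less_LF [simp]: "(LF i, LF j) \<in> letter_less \<longleftrightarrow> j < i"
  by (auto simp: letter_less_def)

lemma Lf_less_LF [simp]: "(Lf i, LF j) \<in> letter_less"
  by (auto simp: letter_less_def)

definition commutator :: "'y \<Rightarrow> 'y \<Rightarrow> ('y list \<Rightarrow>\<^sub>0 'k::field)" where
  "commutator x y = word [x, y] - word [y, x]"

text \<open>The element \<open>c(i,w,k)\<close> for an arbitrary list and arbitrary indices: the
  reductions pass through elements outside the basis, and antisymmetry in \<open>i\<close> and
  \<open>k\<close> brings any two distinct indices to \<open>i < k\<close>.\<close>

definition exchange :: "'i \<Rightarrow> 'i list \<Rightarrow> 'i \<Rightarrow> ('i letter list \<Rightarrow>\<^sub>0 'k::field)" where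
  "exchange i ss k = word (LF i # map Lf ss @ [Lf k]) - word (Lf k # LF i # map Lf ss)
     - word (LF k # map Lf ss @ [Lf i]) + word (Lf i # LF k # map Lf ss)"

lemma commutator_refl: "commutator x x = 0"
  by (simp add: commutator_def)

lemma commutator_swap: "commutator y x = - commutator x y"
  by (simp add: commutator_def)

lemma exchange_refl: "exchange i ss i = 0"
  by (simp add: exchange_def)

lemma exchange_swap: "exchange k ss i = - exchange i ss k"
  by (simp add: exchange_def)

lemma U_Lie2_GS_eq:
  "(U_Lie2_GS I :: ('i::wellorder letter list \<Rightarrow>\<^sub>0 'k::field) set) =
     {commutator (Lf j) (Lf i) | i j. i \<in> I \<and> j \<in> I \<and> i < j}
   \<union> {commutator (LF i) (LF j) | i j. i \<in> I \<and> j \<in> I \<and> i < j}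
   \<union> {exchange i ss k | i k ss. i \<in> I \<and> k \<in> I \<and> set ss \<subseteq> I \<and> sorted ss
        \<and> (ss \<noteq> [] \<longrightarrow> last ss \<le> i) \<and> i < k}"
  unfolding U_Lie2_GS_def
  by (simp add: commutator_def exchange_def gen_f_def gen_F_def gen_fs_def word_mult)

lemma U_Lie2_relators_eq:
  "(U_Lie2_relators I :: ('i letter list \<Rightarrow>\<^sub>0 'k::field) set) =
     {commutator (Lf i) (Lf j) | i j. i \<in> I \<and> j \<in> I}
   \<union> {commutator (LF i) (LF j) | i j. i \<in> I \<and> j \<in> I}
   \<union> {exchange i [] j | i j. i \<in> I \<and> j \<in> I}"
  unfolding U_Lie2_relators_def
  by (simp add: commutator_def exchange_def gen_f_def gen_F_def gen_fs_def word_mult algebra_simps)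

lemma sorted_last_le_iff:
  fixes ss :: "'a::linorder list"
  assumes "sorted ss"
  shows "(ss \<noteq> [] \<longrightarrow> last ss \<le> i) \<longleftrightarrow> (\<forall>s\<in>set ss. s \<le> i)"
  using assms by (cases ss rule: rev_cases) (auto simp: sorted_append intro: order_trans)

lemma commutator_lead:
  assumes "(y, x) \<in> letter_less"
  shows "lead deglex (commutator x y :: _ \<Rightarrow>\<^sub>0 'k::field) = [x, y]"
    and "monic deglex (commutator x y :: _ \<Rightarrow>\<^sub>0 'k::field)"
  using lead_monic_minus[of "word [y, x] :: _ \<Rightarrow>\<^sub>0 'k" "[x, y]"] assms
  by (auto simp: commutator_def deglex_Cons)

text \<open>All four words have the same length, so the first letters decide:
  \<open>F_k < F_i\<close> by the reversed order on the \<open>F\<close>s, and every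
  \<open>f\<close> lies below every \<open>F\<close>.\<close>

lemma exchange_lead:
  fixes i k :: "'i::wellorder"
  assumes "i < k"
  shows "lead deglex (exchange i ss k :: _ \<Rightarrow>\<^sub>0 'k::field) = LF i # map Lf ss @ [Lf k]"
    and "monic deglex (exchange i ss k :: _ \<Rightarrow>\<^sub>0 'k::field)"
proof -
  let ?a = "word (Lf k # LF i # map Lf ss) :: _ \<Rightarrow>\<^sub>0 'k"
  let ?b = "word (LF k # map Lf ss @ [Lf i]) :: _ \<Rightarrow>\<^sub>0 'k"
  let ?c = "word (Lf i # LF k # map Lf ss) :: _ \<Rightarrow>\<^sub>0 'k"
  have "Poly_Mapping.keys (?a + ?b - ?c) \<subseteq>
      {Lf k # LF i # map Lf ss, LF k # map Lf ss @ [Lf i], Lf i # LF k # map Lf ss}"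
    using keys_diff[of "?a + ?b" ?c] Poly_Mapping.keys_add[of ?a ?b] by auto
  then have "(u, LF i # map Lf ss @ [Lf k]) \<in> deglex"
    if "u \<in> Poly_Mapping.keys (?a + ?b - ?c)" for u
    using that assms by (auto simp: letter_less_def intro!: deglex_Cons)
  note * = lead_monic_minus[of "?a + ?b - ?c", OF this]
  have "exchange i ss k = word (LF i # map Lf ss @ [Lf k]) - (?a + ?b - ?c)"
    by (simp add: exchange_def)
  with * show "lead deglex (exchange i ss k :: _ \<Rightarrow>\<^sub>0 'k) = LF i # map Lf ss @ [Lf k]"
    and "monic deglex (exchange i ss k :: _ \<Rightarrow>\<^sub>0 'k)" by auto
qed

lemma U_Lie2_GS_cases:
  fixes I :: "'i::wellorder set"
  assumes "s \<in> (U_Lie2_GS I :: ('i letter list \<Rightarrow>\<^sub>0 'k::field) set)"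
  obtains (f) i j where "i \<in> I" "j \<in> I" "i < j" "s = commutator (Lf j) (Lf i)"
      "lead deglex s = [Lf j, Lf i]"
  | (F) i j where "i \<in> I" "j \<in> I" "i < j" "s = commutator (LF i) (LF j)"
      "lead deglex s = [LF i, LF j]"
  | (fF) i ss k where "i \<in> I" "k \<in> I" "set ss \<subseteq> I" "sorted ss" "\<forall>x\<in>set ss. x \<le> i" "i < k"
      "s = exchange i ss k" "lead deglex s = LF i # map Lf ss @ [Lf k]"
proof -
  from assms consider
      i j where "i \<in> I" "j \<in> I" "i < j" "s = commutator (Lf j) (Lf i)"
    | i j where "i \<in> I" "j \<in> I" "i < j" "s = commutator (LF i) (LF j)"
    | i ss k where "i \<in> I" "k \<in> I" "set ss \<subseteq> I" "sorted ss" "ss \<noteq> [] \<longrightarrow> last ss \<le> i" "i < k"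
        "s = exchange i ss k"
    unfolding U_Lie2_GS_eq by blast
  then show thesis
    using that by cases (simp_all add: commutator_lead exchange_lead sorted_last_le_iff)
qed

text \<open>A leading word \<open>F_i w f_k\<close> has its only \<open>F\<close> in front, a
  nondecreasing tail, and no index above \<open>i\<close> before the final \<open>k\<close>; this
  excludes every other leading word as a factor. Hence inclusion compositions vanish and only proper
  overlaps remain.\<close>

lemma U_Lie2_GS_lead_subword:
  fixes I :: "'i::wellorder set"
  assumes f: "f \<in> (U_Lie2_GS I :: ('i letter list \<Rightarrow>\<^sub>0 'k::field) set)" and g: "g \<in> U_Lie2_GS I"
    and eq: "lead deglex f = a @ lead deglex g @ b"
  shows "f = g \<and> a = [] \<and> b = []"
  using f
proof (cases rule: U_Lie2_GS_cases)
  case (f i j)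
  from g show ?thesis
    by (cases rule: U_Lie2_GS_cases) (use eq f in \<open>auto simp: Cons_eq_append_conv append_eq_Cons_conv\<close>)
next
  case (F i j)
  from g show ?thesis
    by (cases rule: U_Lie2_GS_cases) (use eq F in \<open>auto simp: Cons_eq_append_conv append_eq_Cons_conv\<close>)
next
  case (fF i ss k)
  have sorted: "sorted (ss @ [k])"
    using fF by (auto simp: sorted_append)
  from g show ?thesis
  proof (cases rule: U_Lie2_GS_cases)
    case (f i' j')
    with eq fF have *: "LF i # map Lf (ss @ [k]) = a @ Lf j' # Lf i' # b" by simp
    then obtain a' where "map Lf (ss @ [k]) = a' @ Lf j' # Lf i' # b"
      by (cases a) auto
    then obtain p q where "ss @ [k] = p @ j' # i' # q"
      by (fastforce simp only: map_eq_append_conv map_eq_Cons_conv letter.inject)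
    with sorted have "sorted (p @ j' # i' # q)" by simp
    with f show ?thesis by (auto simp: sorted_append)
  next
    case (F i' j')
    with eq fF have *: "LF i # map Lf (ss @ [k]) = a @ LF i' # LF j' # b" by simp
    have "LF j' \<in> set (tl (a @ LF i' # LF j' # b))"
      by (cases a) auto
    then show ?thesis by (auto simp flip: *)
  next
    case g: (fF i' ss' k')
    with eq fF have *: "LF i # map Lf (ss @ [k]) = a @ LF i' # map Lf (ss' @ [k']) @ b" by simp
    have "a = []"
    proof (rule ccontr)
      assume "a \<noteq> []"
      then have "LF i' \<in> set (tl (LF i # map Lf (ss @ [k])))"
        by (subst *, cases a) auto
      then show False by auto
    qed
    with * have i: "i' = i" and b: "map Lf (ss @ [k]) = map Lf (ss' @ [k']) @ b" by auto
    \<comment> \<open>With \<open>b\<close> nonempty, \<open>k'\<close> would be an index of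
      \<open>w\<close>; but \<open>k' > i' = i\<close> while \<open>w \<le> i\<close>.\<close>
    have "b = []"
    proof (rule ccontr)
      assume "b \<noteq> []"
      then have "map Lf ss = map Lf ss' @ Lf k' # butlast b"
        using arg_cong[OF b, of butlast] by (simp add: butlast_append)
      then have "Lf k' \<in> set (map Lf ss)" by simp
      then have "k' \<in> set ss" by auto
      with fF g i show False by force
    qed
    with b have "map Lf (ss @ [k]) = map Lf (ss' @ [k'])" by simp
    then have "ss @ [k] = ss' @ [k']"
      by (subst (asm) inj_map_eq_map) (auto simp: inj_def)
    with fF g i \<open>a = []\<close> \<open>b = []\<close> show ?thesis by simp
  qed
qed

section \<open>Consequences of the relations in a fixed degree\<close>

text \<open>Sorting by adjacent swaps: each swap costs one commutator inside a word of length
  \<open>N\<close>. The abstract \<open>D\<close> serves twice, as an ideal and as the set of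
  elements that become trivial behind a fixed first letter.\<close>

lemma word_permute_mem:
  fixes D :: "('i letter list \<Rightarrow>\<^sub>0 'k::field) set"
  assumes add: "0 \<in> D" "\<And>p q. p \<in> D \<Longrightarrow> q \<in> D \<Longrightarrow> p + q \<in> D"
    and comm: "\<And>a b x y. a \<in> lists (letters I) \<Longrightarrow> b \<in> lists (letters I) \<Longrightarrow> x \<in> I \<Longrightarrow> y \<in> I
       \<Longrightarrow> length a + length b + 2 = N \<Longrightarrow> word a * commutator (Lf x) (Lf y) * word b \<in> D"
  assumes "a \<in> lists (letters I)" "b \<in> lists (letters I)" "set u \<subseteq> I"
    "length a + length u + length b = N" "mset u = mset u'"
  shows "word (a @ map Lf u @ b) - word (a @ map Lf u' @ b) \<in> D"
proof -
  have Lf: "map Lf u \<in> lists (letters I)" if "set u \<subseteq> I" for u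
    using that by auto
  \<comment> \<open>One letter travels across a block, with one commutator per letter
    passed.\<close>
  have move: "word (a @ Lf x # map Lf p @ b) - word (a @ map Lf p @ Lf x # b) \<in> D"
    if "a \<in> lists (letters I)" "b \<in> lists (letters I)" "x \<in> I" "set p \<subseteq> I"
      "length a + length p + length b + 1 = N" for a b x p
    using that
  proof (induction p arbitrary: a)
    case (Cons y p)
    have "word (a @ Lf x # map Lf (y # p) @ b) - word (a @ map Lf (y # p) @ Lf x # b)
       = word a * commutator (Lf x) (Lf y) * word (map Lf p @ b)
         + (word ((a @ [Lf y]) @ Lf x # map Lf p @ b) - word ((a @ [Lf y]) @ map Lf p @ Lf x # b)
            :: _ \<Rightarrow>\<^sub>0 'k)"
      by (simp add: commutator_def algebra_simps word_mult)
    moreover have "word a * commutator (Lf x) (Lf y) * word (map Lf p @ b) \<in> D"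
      by (rule comm) (use Cons.prems in auto)
    moreover have "word ((a @ [Lf y]) @ Lf x # map Lf p @ b) - word ((a @ [Lf y]) @ map Lf p @ Lf x # b) \<in> D"
      by (rule Cons.IH) (use Cons.prems in auto)
    ultimately show ?case using add(2) by metis
  qed (simp add: add)
  show ?thesis
    using assms(4-)
  proof (induction u arbitrary: a u')
    case (Cons x u)
    then have "x \<in> set u'" by (metis list.set_intros(1) set_mset_mset)
    \<comment> \<open>The induction hypothesis turns the rest of \<open>u\<close> into
      \<open>p @ q\<close>; then \<open>x\<close> moves behind \<open>p\<close>.\<close>
    then obtain p q where u': "u' = p @ x # q" by (meson split_list)
    with Cons.prems have m: "mset u = mset (p @ q)" by simp
    then have set: "set p \<union> set q = set u" by (metis set_append set_mset_mset)
    have len: "length u = length p + length q" using m by (metis length_append size_mset)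
    have "word (a @ map Lf (x # u) @ b) - word (a @ map Lf u' @ b)
       = (word ((a @ [Lf x]) @ map Lf u @ b) - word ((a @ [Lf x]) @ map Lf (p @ q) @ b))
         + (word (a @ Lf x # map Lf p @ (map Lf q @ b)) - word (a @ map Lf p @ Lf x # (map Lf q @ b))
            :: _ \<Rightarrow>\<^sub>0 'k)"
      by (simp add: u')
    moreover have "word ((a @ [Lf x]) @ map Lf u @ b) - word ((a @ [Lf x]) @ map Lf (p @ q) @ b) \<in> D"
      by (rule Cons.IH) (use Cons.prems m in auto)
    moreover have "word (a @ Lf x # map Lf p @ (map Lf q @ b)) - word (a @ map Lf p @ Lf x # (map Lf q @ b)) \<in> D"
      by (rule move) (use Cons.prems set len in auto)
    ultimately show ?case using add(2) by metis
  qed (simp add: add)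
qed

text \<open>The exchange elements for arbitrary words arise from those for the empty word by
  right multiplication, up to commuting the letters \<open>f\<^sub>i\<close>.\<close>

lemma exchange_mem:
  fixes D :: "('i letter list \<Rightarrow>\<^sub>0 'k::field) set"
  assumes add: "0 \<in> D" "\<And>p q. p \<in> D \<Longrightarrow> q \<in> D \<Longrightarrow> p + q \<in> D"
    and comm: "\<And>a b x y. a \<in> lists (letters I) \<Longrightarrow> b \<in> lists (letters I) \<Longrightarrow> x \<in> I \<Longrightarrow> y \<in> I
       \<Longrightarrow> length a + length b + 2 = N \<Longrightarrow> word a * commutator (Lf x) (Lf y) * word b \<in> D"
    and exch: "\<And>a b x y. a \<in> lists (letters I) \<Longrightarrow> b \<in> lists (letters I) \<Longrightarrow> x \<in> I \<Longrightarrow> y \<in> I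
       \<Longrightarrow> length a + length b + 2 = N \<Longrightarrow> word a * exchange x [] y * word b \<in> D"
  assumes "a \<in> lists (letters I)" "b \<in> lists (letters I)" "i \<in> I" "k \<in> I" "set ss \<subseteq> I"
    "length a + length ss + length b + 2 = N"
  shows "word a * exchange i ss k * word b \<in> D"
proof -
  let ?ss = "map Lf ss"
  \<comment> \<open>The terms \<open>f_k F_i w\<close> and \<open>f_i F_k w\<close> agree at once;
    the corrections carry \<open>f_k\<close> and \<open>f_i\<close> across \<open>w\<close> in the
    other two.\<close>
  have "word a * exchange i ss k * word b =
      word a * exchange i [] k * word (?ss @ b)
      + (word ((a @ [LF i]) @ map Lf (ss @ [k]) @ b) - word ((a @ [LF i]) @ map Lf (k # ss) @ b))
      + (word ((a @ [LF k]) @ map Lf (i # ss) @ b) - word ((a @ [LF k]) @ map Lf (ss @ [i]) @ b)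
         :: _ \<Rightarrow>\<^sub>0 'k)"
    by (simp add: exchange_def algebra_simps word_mult)
  moreover have "word a * exchange i [] k * word (?ss @ b) \<in> D"
    by (rule exch) (use assms(5-) in auto)
  moreover have "word ((a @ [LF i]) @ map Lf (ss @ [k]) @ b) - word ((a @ [LF i]) @ map Lf (k # ss) @ b) \<in> D"
    by (rule word_permute_mem[OF add comm, where I = I and N = N]) (use assms(5-) in auto)
  moreover have "word ((a @ [LF k]) @ map Lf (i # ss) @ b) - word ((a @ [LF k]) @ map Lf (ss @ [i]) @ b) \<in> D"
    by (rule word_permute_mem[OF add comm, where I = I and N = N]) (use assms(5-) in auto)
  ultimately show ?thesis using add(2) by metis
qed

section \<open>Multiples of relations below a composition word\<close>

abbreviation (input) GS_trivial ::
  "'i::wellorder set \<Rightarrow> 'i letter list \<Rightarrow> ('i letter list \<Rightarrow>\<^sub>0 'k::field) \<Rightarrow> bool" where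
  "GS_trivial I v h \<equiv> trivial_modulo (letters I) deglex (U_Lie2_GS I) v h"

lemma GS_memI:
  shows "i \<in> I \<Longrightarrow> j \<in> I \<Longrightarrow> i < j \<Longrightarrow> commutator (Lf j) (Lf i) \<in> U_Lie2_GS I"
    and "i \<in> I \<Longrightarrow> j \<in> I \<Longrightarrow> i < j \<Longrightarrow> commutator (LF i) (LF j) \<in> U_Lie2_GS I"
    and "i \<in> I \<Longrightarrow> k \<in> I \<Longrightarrow> set ss \<subseteq> I \<Longrightarrow> sorted ss \<Longrightarrow> \<forall>s\<in>set ss. s \<le> i \<Longrightarrow> i < k
      \<Longrightarrow> exchange i ss k \<in> U_Lie2_GS I"
proof -
  assume "i \<in> I" "k \<in> I" "set ss \<subseteq> I" "sorted ss" "\<forall>s\<in>set ss. s \<le> i" "i < k"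
  then show "exchange i ss k \<in> U_Lie2_GS I"
    using sorted_last_le_iff[of ss i] unfolding U_Lie2_GS_eq by blast
qed (unfold U_Lie2_GS_eq, blast+)

lemma commutator_trivial:
  assumes "a \<in> lists (letters I)" "b \<in> lists (letters I)" "x \<in> I" "y \<in> I" "x < y"
  shows "(a @ [Lf y, Lf x] @ b, v) \<in> deglex \<Longrightarrow>
      GS_trivial I v (word a * commutator (Lf y) (Lf x) * word b)"
    and "(a @ [LF x, LF y] @ b, v) \<in> deglex \<Longrightarrow>
      GS_trivial I v (word a * commutator (LF x) (LF y) * word b)"
  using trivial_modulo_term[OF assms(1,2) GS_memI(1)[OF assms(3-5)], of deglex v]
    trivial_modulo_term[OF assms(1,2) GS_memI(2)[OF assms(3-5)], of deglex v] assms(5)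
  by (simp_all add: commutator_lead)

lemma exchange_trivial:
  assumes "a \<in> lists (letters I)" "b \<in> lists (letters I)" "i \<in> I" "k \<in> I" "set ss \<subseteq> I"
    "sorted ss" "\<forall>s\<in>set ss. s \<le> i" "i < k"
    "(a @ LF i # map Lf ss @ Lf k # b, v) \<in> deglex"
  shows "GS_trivial I v (word a * exchange i ss k * word b)"
  using trivial_modulo_term[OF assms(1,2) GS_memI(3)[OF assms(3-8)], of deglex v] assms(8,9)
  by (simp add: exchange_lead)

text \<open>A first letter \<open>z\<close> below \<open>c\<close> makes every word of the same
  length smaller than \<open>c # v\<close>, whatever follows. So the indices may come in any order:
  equal ones give zero, and the wrong order only changes the sign.\<close>

lemma commutator_trivial_below:
  assumes "(z, c) \<in> letter_less" "z \<in> letters I" "a \<in> lists (letters I)" "b \<in> lists (letters I)"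
    "x \<in> I" "y \<in> I" "length a + length b + 2 = length v"
  shows "GS_trivial I (c # v) (word (z # a) * commutator (Lf x) (Lf y) * word b)"
proof (cases x y rule: linorder_cases)
  case less
  then have "GS_trivial I (c # v) (word (z # a) * commutator (Lf y) (Lf x) * word b)"
    by (intro commutator_trivial) (use assms in \<open>auto intro!: deglex_Cons\<close>)
  then show ?thesis
    by (subst commutator_swap) (auto dest: trivial_modulo_uminus)
next
  case greater
  then show ?thesis
    by (intro commutator_trivial) (use assms in \<open>auto intro!: deglex_Cons\<close>)
qed (simp add: commutator_refl trivial_modulo_0)

lemma exchange_Nil_trivial_below:
  assumes "(z, c) \<in> letter_less" "z \<in> letters I" "a \<in> lists (letters I)" "b \<in> lists (letters I)"
    "x \<in> I" "y \<in> I" "length a + length b + 2 = length v"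
  shows "GS_trivial I (c # v) (word (z # a) * exchange x [] y * word b)"
proof (cases x y rule: linorder_cases)
  case greater
  then have "GS_trivial I (c # v) (word (z # a) * exchange y [] x * word b)"
    by (intro exchange_trivial) (use assms in \<open>auto intro!: deglex_Cons\<close>)
  then show ?thesis
    by (subst exchange_swap) (auto dest: trivial_modulo_uminus)
next
  case less
  then show ?thesis
    by (intro exchange_trivial) (use assms in \<open>auto intro!: deglex_Cons\<close>)
qed (simp add: exchange_refl trivial_modulo_0)

lemma word_Cons: "(word (z # a) :: 'y list \<Rightarrow>\<^sub>0 'k::field) = word [z] * word a"
  by (simp add: word_mult)

lemma permute_trivial_below:
  fixes I :: "'i::wellorder set"
  assumes "(z, c) \<in> letter_less" "z \<in> letters I" "a \<in> lists (letters I)" "b \<in> lists (letters I)"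
    "set u \<subseteq> I" "mset u = mset u'" "length a + length u + length b = length v"
  shows "GS_trivial I (c # v)
    (word (z # a @ map Lf u @ b) - word (z # a @ map Lf u' @ b) :: _ \<Rightarrow>\<^sub>0 'k::field)"
proof -
  let ?D = "{p :: _ \<Rightarrow>\<^sub>0 'k. GS_trivial I (c # v) (word [z] * p)}"
  have "word (a @ map Lf u @ b) - word (a @ map Lf u' @ b) \<in> ?D"
  proof (rule word_permute_mem[where I = I and N = "length v"])
    show "word a * commutator (Lf x) (Lf y) * word b \<in> ?D"
      if "a \<in> lists (letters I)" "b \<in> lists (letters I)" "x \<in> I" "y \<in> I"
        "length a + length b + 2 = length v" for a b x y
      using commutator_trivial_below[OF assms(1,2) that]
      by (subst (asm) word_Cons) (simp add: mult.assoc)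
  qed (use assms in \<open>auto simp: trivial_modulo_0 distrib_left intro: trivial_modulo_add\<close>)
  then show ?thesis
    by (simp add: algebra_simps word_mult)
qed

text \<open>Here \<open>exchange_mem\<close> is applied to the elements that become trivial once
  \<open>z\<close> is put in front. This gives access to \<open>c(i,w,k)\<close> outside the basis,
  with \<open>w\<close> unsorted or with indices above \<open>i\<close>.\<close>

lemma exchange_trivial_below:
  fixes I :: "'i::wellorder set"
  assumes "(z, c) \<in> letter_less" "z \<in> letters I" "a \<in> lists (letters I)" "b \<in> lists (letters I)"
    "i \<in> I" "k \<in> I" "set ss \<subseteq> I" "length a + length ss + length b + 2 = length v"
  shows "GS_trivial I (c # v) (word (z # a) * exchange i ss k * word b :: _ \<Rightarrow>\<^sub>0 'k::field)"
proof -
  let ?D = "{p :: _ \<Rightarrow>\<^sub>0 'k. GS_trivial I (c # v) (word [z] * p)}"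
  have "word a * exchange i ss k * word b \<in> ?D"
  proof (rule exchange_mem[where I = I and N = "length v"])
    show "word a * commutator (Lf x) (Lf y) * word b \<in> ?D"
      if "a \<in> lists (letters I)" "b \<in> lists (letters I)" "x \<in> I" "y \<in> I"
        "length a + length b + 2 = length v" for a b x y
      using commutator_trivial_below[OF assms(1,2) that]
      by (subst (asm) word_Cons) (simp add: mult.assoc)
    show "word a * exchange x [] y * word b \<in> ?D"
      if "a \<in> lists (letters I)" "b \<in> lists (letters I)" "x \<in> I" "y \<in> I"
        "length a + length b + 2 = length v" for a b x y
      using exchange_Nil_trivial_below[OF assms(1,2) that]
      by (subst (asm) word_Cons) (simp add: mult.assoc)
  qed (use assms in \<open>auto simp: trivial_modulo_0 distrib_left intro: trivial_modulo_add\<close>)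
  then show ?thesis
    by (subst word_Cons) (simp add: mult.assoc)
qed

section \<open>Insertion of an index into a sorted word\<close>

lemma sorted_insort_last:
  "sorted (ss @ [y]) \<Longrightarrow> y \<le> x \<Longrightarrow> insort x (ss @ [y]) = ss @ [y, x]"
  by (rule properties_for_sort[symmetric, THEN trans, OF _ _ sorted_sort_id, rotated -1])
     (auto simp: sorted_append sorted_insort intro: order_trans)

lemma insort_snoc: "x < y \<Longrightarrow> insort x (ss @ [y]) = insort x ss @ [y]"
  by (induction ss) auto

text \<open>Each swap carrying \<open>x\<close> to the left reverses a descent and lowers the word.
  This bounds the leading word of the exchange element whose middle word is \<open>w\<close> with an
  index inserted.\<close>

lemma insort_deglex:
  "sorted ss \<Longrightarrow> insort x ss = ss @ [x] \<or> (map Lf (insort x ss), map Lf (ss @ [x])) \<in> deglex"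
proof (induction ss rule: rev_induct)
  case (snoc y ss)
  show ?case
  proof (cases "y \<le> x")
    case False
    then have "([Lf x, Lf y], [Lf y, Lf x]) \<in> deglex"
      by (auto intro!: deglex_Cons)
    from deglex_append[OF this, of "map Lf ss" "[]"]
    have "(map Lf (ss @ [x, y]), map Lf (ss @ [y, x])) \<in> deglex" by simp
    moreover have "insort x ss = ss @ [x] \<or>
        (map Lf (insort x ss @ [y]), map Lf (ss @ [x, y])) \<in> deglex"
      using snoc deglex_append[of "map Lf (insort x ss)" "map Lf (ss @ [x])" "[]" "[Lf y]"]
      by (auto simp: sorted_append)
    ultimately show ?thesis
      using False by (auto simp: insort_snoc intro: deglex_trans)
  qed (use snoc.prems in \<open>simp add: sorted_insort_last\<close>)
qed simp

text \<open>Serves words that share the first letter of the composition word, where rewriting has to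
  be decreasing. Insertion from the right swaps descents only.\<close>

lemma insort_trivial:
  fixes I :: "'i::wellorder set"
  assumes "a \<in> lists (letters I)" "b \<in> lists (letters I)" "x \<in> I" "set ss \<subseteq> I" "sorted ss"
    "(a @ map Lf (ss @ [x]) @ b, v) \<in> deglex"
  shows "GS_trivial I v
    (word (a @ map Lf (ss @ [x]) @ b) - word (a @ map Lf (insort x ss) @ b) :: _ \<Rightarrow>\<^sub>0 'k::field)"
  using assms
proof (induction ss arbitrary: b rule: rev_induct)
  case (snoc y ss)
  show ?case
  proof (cases "y \<le> x")
    case True
    with snoc.prems show ?thesis by (simp add: sorted_insort_last trivial_modulo_0)
  next
    case False
    then have "x < y" by simp
    let ?a = "a @ map Lf ss"
    have "([Lf x, Lf y], [Lf y, Lf x]) \<in> deglex"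
      using \<open>x < y\<close> by (auto intro!: deglex_Cons)
    from deglex_append[OF this, of ?a b]
    have less: "(a @ map Lf (ss @ [x]) @ (Lf y # b), v) \<in> deglex"
      using snoc.prems(6) by (auto intro: deglex_trans)
    have "word (a @ map Lf ((ss @ [y]) @ [x]) @ b) - word (a @ map Lf (insort x (ss @ [y])) @ b)
      = word ?a * commutator (Lf y) (Lf x) * word b
        + (word (a @ map Lf (ss @ [x]) @ (Lf y # b)) - word (a @ map Lf (insort x ss) @ (Lf y # b))
           :: _ \<Rightarrow>\<^sub>0 'k)"
      using \<open>x < y\<close> by (simp add: insort_snoc commutator_def algebra_simps word_mult)
    moreover have "GS_trivial I v (word ?a * commutator (Lf y) (Lf x) * word b :: _ \<Rightarrow>\<^sub>0 'k)"
      by (rule commutator_trivial) (use snoc.prems \<open>x < y\<close> in auto)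
    moreover have "GS_trivial I v
        (word (a @ map Lf (ss @ [x]) @ (Lf y # b)) - word (a @ map Lf (insort x ss) @ (Lf y # b))
         :: _ \<Rightarrow>\<^sub>0 'k)"
      by (rule snoc.IH) (use snoc.prems less in \<open>auto simp: sorted_append\<close>)
    ultimately show ?thesis
      using trivial_modulo_add by metis
  qed
qed (simp add: trivial_modulo_0)

section \<open>The compositions for the four kinds of overlap\<close>

text \<open>Covers \<open>f_k f_j f_i\<close> and \<open>F_i F_j F_k\<close> at once: both are
  strictly decreasing words \<open>xyz\<close> whose letters commute pairwise modulo the
  basis.\<close>

lemma commuting_triple_trivial:
  fixes x y z :: "'i::wellorder letter"
  assumes "{commutator x y, commutator y z, commutator x z}
      \<subseteq> (U_Lie2_GS I :: (_ \<Rightarrow>\<^sub>0 'k::field) set)"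
    "{x, y, z} \<subseteq> letters I"
    "(y, x) \<in> letter_less" "(z, y) \<in> letter_less" "(z, x) \<in> letter_less"
  shows "GS_trivial I [x, y, z]
    (commutator x y * word [z] - word [x] * commutator y z :: _ \<Rightarrow>\<^sub>0 'k)"
proof -
  have summand: "GS_trivial I [x, y, z] (word a * commutator p q * word b :: _ \<Rightarrow>\<^sub>0 'k)"
    if "commutator p q \<in> (U_Lie2_GS I :: (_ \<Rightarrow>\<^sub>0 'k) set)" "(q, p) \<in> letter_less"
      "set a \<union> set b \<subseteq> {x, y, z}" "(a @ [p, q] @ b, [x, y, z]) \<in> deglex" for a b p q
    by (rule trivial_modulo_term) (use that assms in \<open>auto simp: commutator_lead\<close>)
  \<comment> \<open>The composition equals \<open>xzy - yxz\<close>, and both words are rewritten to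
    \<open>zyx\<close> through words below \<open>xyz\<close>.\<close>
  have "commutator x y * word [z] - word [x] * commutator y z =
      word [] * commutator x z * word [y] - word [y] * commutator x z * word []
      + word [z] * commutator x y * word [] - (word [] * commutator y z * word [x] :: _ \<Rightarrow>\<^sub>0 'k)"
    by (simp add: commutator_def algebra_simps word_mult)
  then show ?thesis
    by (simp only:)
       (intro trivial_modulo_add trivial_modulo_diff summand;
        use assms in \<open>auto simp: deglex_def Cons_lenlex_iff\<close>)
qed

text \<open>Summands led by \<open>F_i\<close> are exchanges with \<open>w = 1\<close> or the
  commutator of \<open>F_i\<close> and \<open>F_k\<close>; their second letter, an \<open>f\<close>
  or \<open>F_k\<close>, is below \<open>F_j\<close>. Exchanges with middle word \<open>w\<close>
  occur only behind \<open>F_j\<close> or \<open>F_k\<close>, where every \<open>w\<close> is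
  allowed.\<close>

lemma F_exchange_composition_trivial:
  fixes I :: "'i::wellorder set"
  assumes I: "i \<in> I" "j \<in> I" "k \<in> I" "set ss \<subseteq> I" and "i < j" "j < k"
  shows "GS_trivial I (LF i # LF j # map Lf ss @ [Lf k])
    (commutator (LF i) (LF j) * word (map Lf ss @ [Lf k]) - word [LF i] * exchange j ss k
      :: _ \<Rightarrow>\<^sub>0 'k::field)"
proof -
  let ?w = "map Lf ss"
  have "commutator (LF i) (LF j) * word (?w @ [Lf k]) - word [LF i] * exchange j ss k =
      word [] * exchange i [] k * word (LF j # ?w) - word [] * exchange i [] j * word (LF k # ?w)
      + word [] * commutator (LF i) (LF k) * word (?w @ [Lf j])
      - word [LF j] * exchange i ss k * word [] + word [LF k] * exchange i ss j * word []
      - word [] * exchange j [] k * word (LF i # ?w)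
      + word [Lf k] * commutator (LF i) (LF j) * word ?w
      + word [Lf i] * commutator (LF j) (LF k) * word ?w
      - word [Lf j] * commutator (LF i) (LF k) * word ?w
      - (word [] * commutator (LF j) (LF k) * word (?w @ [Lf i]) :: _ \<Rightarrow>\<^sub>0 'k)"
    by (simp add: commutator_def exchange_def algebra_simps word_mult)
  moreover have "i < k" using assms by simp
  ultimately show ?thesis
    using assms
    by (simp only:)
       (intro trivial_modulo_add trivial_modulo_diff exchange_trivial_below;
        (intro exchange_trivial commutator_trivial)?;
        auto simp: deglex_def Cons_lenlex_iff)
qed

text \<open>The composition is led by \<open>F_i w f_j f_k\<close>. For \<open>j \<le> i\<close> the
  letter \<open>f_j\<close> is absorbed into the middle word; for \<open>i < j\<close> it completes
  a shorter leading word \<open>F_i w f_j\<close>.\<close>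

lemma exchange_f_composition_trivial:
  fixes I :: "'i::wellorder set"
  assumes I: "i \<in> I" "j \<in> I" "k \<in> I" "set ss \<subseteq> I" and ss: "sorted ss" "\<forall>s\<in>set ss. s \<le> i"
    and "i < k" "j < k"
  shows "GS_trivial I (LF i # map Lf ss @ [Lf k, Lf j])
    (exchange i ss k * word [Lf j] - word (LF i # map Lf ss) * commutator (Lf k) (Lf j)
      :: _ \<Rightarrow>\<^sub>0 'k::field)"
    (is "GS_trivial I ?v ?h")
proof -
  let ?w = "map Lf ss"
  \<comment> \<open>Words keeping \<open>F_i\<close> in front are compared with the overlap word
    through this one, where the final descent is already reversed.\<close>
  have swap: "(LF i # ?w @ [Lf j, Lf k], ?v) \<in> deglex"
    using deglex_append[OF deglex_Cons, of "[Lf k]" "[Lf j]" "Lf j" "Lf k" "LF i # ?w" "[]"] \<open>j < k\<close>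
    by simp
  show ?thesis
  proof (cases "j \<le> i")
    case True
    let ?u = "insort j ss"
    let ?u' = "map Lf ?u"
    \<comment> \<open>Up to permuting \<open>f\<close>s the composition is \<open>c(i,u,k)\<close>
      with \<open>u\<close> the sorted form of \<open>w f_j\<close>. Three of the four differences
      begin with a letter below \<open>F_i\<close>; the last needs decreasing insertion.\<close>
    have "?h = word [] * exchange i ?u k * word []
        - (word (Lf k # [LF i] @ map Lf (ss @ [j]) @ []) - word (Lf k # [LF i] @ ?u' @ []))
        - (word (LF k # [] @ map Lf (ss @ [i, j]) @ []) - word (LF k # [] @ map Lf (?u @ [i]) @ []))
        + (word (Lf i # [LF k] @ map Lf (ss @ [j]) @ []) - word (Lf i # [LF k] @ ?u' @ []))
        + (word ([LF i] @ map Lf (ss @ [j]) @ [Lf k]) - word ([LF i] @ ?u' @ [Lf k]) :: _ \<Rightarrow>\<^sub>0 'k)"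
      by (simp add: commutator_def exchange_def algebra_simps word_mult)
    moreover have "GS_trivial I ?v (word [] * exchange i ?u k * word [] :: _ \<Rightarrow>\<^sub>0 'k)"
    proof (rule exchange_trivial)
      have "([LF i] @ map Lf ?u @ [Lf k], [LF i] @ map Lf (ss @ [j]) @ [Lf k]) \<in> deglex"
        if "?u \<noteq> ss @ [j]"
        using deglex_append[of "map Lf ?u" "map Lf (ss @ [j])" "[LF i]" "[Lf k]"]
          insort_deglex[of ss j] ss(1) that by blast
      with swap have "(LF i # map Lf ?u @ [Lf k], ?v) \<in> deglex"
        by (cases "?u = ss @ [j]") (auto intro: deglex_trans)
      then show "([] @ LF i # map Lf ?u @ Lf k # [], ?v) \<in> deglex" by simp
    qed (use assms True in \<open>auto simp: sorted_insort set_insort_key\<close>)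
    moreover have "GS_trivial I ?v
        (word ([LF i] @ map Lf (ss @ [j]) @ [Lf k]) - word ([LF i] @ ?u' @ [Lf k]) :: _ \<Rightarrow>\<^sub>0 'k)"
      by (rule insort_trivial) (use assms swap in auto)
    moreover have "GS_trivial I ?v
        (word (Lf k # [LF i] @ map Lf (ss @ [j]) @ []) - word (Lf k # [LF i] @ ?u' @ []) :: _ \<Rightarrow>\<^sub>0 'k)"
      by (rule permute_trivial_below) (use assms in auto)
    moreover have "GS_trivial I ?v
        (word (Lf i # [LF k] @ map Lf (ss @ [j]) @ []) - word (Lf i # [LF k] @ ?u' @ []) :: _ \<Rightarrow>\<^sub>0 'k)"
      by (rule permute_trivial_below) (use assms in auto)
    moreover have "GS_trivial I ?v (word (LF k # [] @ map Lf (ss @ [i, j]) @ [])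
        - word (LF k # [] @ map Lf (?u @ [i]) @ []) :: _ \<Rightarrow>\<^sub>0 'k)"
      by (rule permute_trivial_below) (use assms in auto)
    ultimately show ?thesis
      by (simp only:) (assumption | rule trivial_modulo_add trivial_modulo_diff)+
  next
    case False
    then have "i < j" by simp
    \<comment> \<open>Exchanging \<open>F_i w f_j\<close> yields \<open>F_j w f_i f_k\<close>, the
      leading word of \<open>exchange j (ss @ [i]) k\<close>. That is a basis element because
      \<open>w \<le> i < j < k\<close>.\<close>
    have "?h = word [] * exchange i ss j * word [Lf k] + word [] * exchange j (ss @ [i]) k * word []
        + word [Lf j] * exchange i ss k * word [] - word [Lf i] * exchange j ss k * word []
        - word [Lf k] * exchange i ss j * word []
        - word [] * commutator (Lf k) (Lf j) * word (LF i # ?w)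
        - word [] * commutator (Lf j) (Lf i) * word (LF k # ?w)
        + (word [] * commutator (Lf k) (Lf i) * word (LF j # ?w) :: _ \<Rightarrow>\<^sub>0 'k)"
      by (simp add: commutator_def exchange_def algebra_simps word_mult)
    moreover have "\<forall>s\<in>set ss. s \<le> j"
      using ss \<open>i < j\<close> by force
    ultimately show ?thesis
      using assms \<open>i < j\<close> swap
      by (simp only:)
         (intro trivial_modulo_add trivial_modulo_diff exchange_trivial_below;
          (intro exchange_trivial commutator_trivial)?;
          auto simp: sorted_append intro!: deglex_Cons)
  qed
qed

section \<open>Equality of the generated ideals\<close>

lemma mult_word_in_ideal:
  assumes "two_sided_ideal Y J" "p \<in> J" "a \<in> lists Y" "b \<in> lists Y"
  shows "word a * p * word b \<in> J"
  using assms by (auto simp: two_sided_ideal_def As_def)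

lemma uminus_in_ideal:
  fixes J :: "('y list \<Rightarrow>\<^sub>0 'k::field) set"
  assumes "two_sided_ideal Y J" "p \<in> J"
  shows "- p \<in> J"
proof -
  \<comment> \<open>The sign comes from multiplying by the constant -1, a multiple of the empty
    word.\<close>
  have "monom (- 1) [] * p \<in> J"
    using assms by (auto simp: two_sided_ideal_def As_def)
  then show ?thesis by (simp add: single_uminus word_Nil)
qed

text \<open>Antisymmetry restores the relators for all index pairs, and \<open>exchange_mem\<close>
  produces the elements with nonempty \<open>w\<close>. Since generated ideals are intersections of
  the ideals containing the generators, this makes them equal.\<close>

lemma U_Lie2_ideal_subset_iff:
  fixes J :: "('i::wellorder letter list \<Rightarrow>\<^sub>0 'k::field) set"
  assumes J: "two_sided_ideal (letters I) J"
  shows "U_Lie2_GS I \<subseteq> J \<longleftrightarrow> U_Lie2_relators I \<subseteq> J"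
proof
  assume S: "U_Lie2_GS I \<subseteq> J"
  have 0: "0 \<in> J" using J by (simp add: two_sided_ideal_def)
  have less: "commutator (Lf j) (Lf i) \<in> J" "commutator (LF i) (LF j) \<in> J" "exchange i [] j \<in> J"
    if "i \<in> I" "j \<in> I" "i < j" for i j
    using that S GS_memI(1,2)[of i I j] GS_memI(3)[of i I j "[]"] by auto
  have "commutator (Lf i) (Lf j) \<in> J" "commutator (LF i) (LF j) \<in> J" "exchange i [] j \<in> J"
    if "i \<in> I" "j \<in> I" for i j
  proof (atomize (full), cases i j rule: linorder_cases)
    case l: less
    with less[of i j] that uminus_in_ideal[OF J, of "commutator (Lf j) (Lf i)"]
    show "commutator (Lf i) (Lf j) \<in> J \<and> commutator (LF i) (LF j) \<in> J \<and> exchange i [] j \<in> J"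
      by (simp flip: commutator_swap)
  next
    case greater
    with less[of j i] that uminus_in_ideal[OF J, of "commutator (LF j) (LF i)"]
      uminus_in_ideal[OF J, of "exchange j [] i"]
    show "commutator (Lf i) (Lf j) \<in> J \<and> commutator (LF i) (LF j) \<in> J \<and> exchange i [] j \<in> J"
      by (simp flip: commutator_swap exchange_swap)
  qed (simp add: commutator_refl exchange_refl 0)
  then show "U_Lie2_relators I \<subseteq> J"
    unfolding U_Lie2_relators_eq by blast
next
  assume R: "U_Lie2_relators I \<subseteq> J"
  have "exchange i ss k \<in> J" if "i \<in> I" "k \<in> I" "set ss \<subseteq> I" for i k ss
  proof -
    have "word [] * exchange i ss k * word [] \<in> J"
    proof (rule exchange_mem)
      show "word a * commutator (Lf x) (Lf y) * word b \<in> J"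
        if "a \<in> lists (letters I)" "b \<in> lists (letters I)" "x \<in> I" "y \<in> I" for a b x y
        by (rule mult_word_in_ideal[OF J _ that(1,2)]) (use that R in \<open>unfold U_Lie2_relators_eq, blast\<close>)
      show "word a * exchange x [] y * word b \<in> J"
        if "a \<in> lists (letters I)" "b \<in> lists (letters I)" "x \<in> I" "y \<in> I" for a b x y
        by (rule mult_word_in_ideal[OF J _ that(1,2)]) (use that R in \<open>unfold U_Lie2_relators_eq, blast\<close>)
    qed (use that J in \<open>auto simp: two_sided_ideal_def\<close>)
    then show ?thesis by (simp add: word_Nil)
  qed
  with R show "U_Lie2_GS I \<subseteq> J"
    unfolding U_Lie2_GS_eq U_Lie2_relators_eq by blast
qed

lemma U_Lie2_GS_subset_As:
  "(U_Lie2_GS I :: ('i::wellorder letter list \<Rightarrow>\<^sub>0 'k::field) set) \<subseteq> As (letters I)"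
proof -
  have "p - q \<in> As Y" "p + q \<in> As Y" if "p \<in> As Y" "q \<in> As Y"
    for p q :: "'i letter list \<Rightarrow>\<^sub>0 'k" and Y
    using that keys_diff[of p q] Poly_Mapping.keys_add[of p q] by (auto simp: As_def)
  moreover have "(word w :: _ \<Rightarrow>\<^sub>0 'k) \<in> As (letters I)" if "w \<in> lists (letters I)" for w
    using that by (auto simp: As_def)
  ultimately show ?thesis
    unfolding U_Lie2_GS_eq by (auto simp: commutator_def exchange_def)
qed

section \<open>Classification of the overlaps\<close>

text \<open>The shared factor \<open>c\<close> ends one leading word and begins the other. So
  \<open>f_j f_i\<close> overlaps only with an \<open>f\<close>-commutator, \<open>F_i F_j\<close>
  with an \<open>F\<close>-commutator or an exchange, and \<open>F_i w f_k\<close> only with an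
  \<open>f\<close>-commutator, in the letter \<open>f_k\<close>.\<close>

lemma GS_proper_overlap_trivial:
  fixes I :: "'i::wellorder set"
  assumes f: "f \<in> (U_Lie2_GS I :: ('i letter list \<Rightarrow>\<^sub>0 'k::field) set)" and g: "g \<in> U_Lie2_GS I"
    and ac: "lead deglex f = a @ c" and cb: "lead deglex g = c @ b"
    and ne: "a \<noteq> []" "b \<noteq> []" "c \<noteq> []"
  shows "GS_trivial I (a @ c @ b) (f * word b - word a * g)"
  using f
proof (cases rule: U_Lie2_GS_cases)
  case f: (f i j)
  with ac ne have a: "a = [Lf j]" and c: "c = [Lf i]"
    by (auto simp: Cons_eq_append_conv append_eq_Cons_conv)
  from g show ?thesis
  proof (cases rule: U_Lie2_GS_cases)
    case g: (f i' j')
    with cb c f have "j' = i" "b = [Lf i']" "i' < j" by auto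
    with f g a c show ?thesis
      using commuting_triple_trivial[of "Lf j" "Lf i" "Lf i'" I] by (auto simp: GS_memI)
  qed (use cb c in auto)
next
  case f: (F i j)
  with ac ne have a: "a = [LF i]" and c: "c = [LF j]"
    by (auto simp: Cons_eq_append_conv append_eq_Cons_conv)
  from g show ?thesis
  proof (cases rule: U_Lie2_GS_cases)
    case g: (F i' j')
    with cb c f have "i' = j" "b = [LF j']" "i < j'" by auto
    with f g a c show ?thesis
      using commuting_triple_trivial[of "LF i" "LF j" "LF j'" I] by (auto simp: GS_memI)
  next
    case g: (fF i' ss k)
    with cb c have "i' = j" "b = map Lf ss @ [Lf k]" by auto
    with f g a c show ?thesis
      using F_exchange_composition_trivial[of i I j k ss] by simp
  qed (use cb c in auto)
next
  case f: (fF i ss k)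
  \<comment> \<open>A nonempty \<open>a\<close> takes up \<open>F_i\<close>, so \<open>c\<close>
    consists of \<open>f\<close>s.\<close>
  with ac ne obtain a' where a: "a = LF i # a'" and "map Lf (ss @ [k]) = a' @ c"
    by (cases a) auto
  then obtain p q where pq: "ss @ [k] = p @ q" "a' = map Lf p" "c = map Lf q"
    by (auto simp only: map_eq_append_conv)
  from g show ?thesis
  proof (cases rule: U_Lie2_GS_cases)
    case g: (f i' j')
    with cb pq ne have "q = [j']" "b = [Lf i']"
      by (auto simp: Cons_eq_append_conv append_eq_Cons_conv)
    with f g a pq show ?thesis
      using exchange_f_composition_trivial[of i I i' k ss] by auto
  qed (use cb pq ne in \<open>cases q; auto\<close>)+
qed

lemma U_Lie2_GS_basis:
  fixes I :: "'i::wellorder set"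
  shows "GS_basis (letters I) deglex (U_Lie2_GS I :: ('i letter list \<Rightarrow>\<^sub>0 'k::field) set)"
  unfolding GS_basis_def
proof (intro conjI ballI allI impI deglex_word_ordering U_Lie2_GS_subset_As)
  fix s :: "'i letter list \<Rightarrow>\<^sub>0 'k"
  assume "s \<in> U_Lie2_GS I"
  then show "monic deglex s"
    by (cases rule: U_Lie2_GS_cases) (auto simp: commutator_lead exchange_lead)
next
  fix f g h :: "'i letter list \<Rightarrow>\<^sub>0 'k" and v
  assume f: "f \<in> U_Lie2_GS I" and g: "g \<in> U_Lie2_GS I"
  assume "intersection_composition (letters I) deglex f g v h \<or>
    inclusion_composition (letters I) deglex f g v h"
  then show "GS_trivial I v h"
  proof
    assume "intersection_composition (letters I) deglex f g v h"
    then obtain a b where ab: "v = lead deglex f @ b" "v = a @ lead deglex g"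
        "length (lead deglex f) + length (lead deglex g) > length v" "h = f * word b - word a * g"
      unfolding intersection_composition_def by blast
    \<comment> \<open>The length condition on \<open>v\<close> makes \<open>a\<close> shorter than
      the leading word of \<open>f\<close>, so the shared factor \<open>c\<close> is
      nonempty.\<close>
    have a: "\<not> length (lead deglex f) \<le> length a"
      using ab by (metis length_append not_less add_le_mono1)
    moreover from ab have "lead deglex f @ b = a @ lead deglex g" by simp
    ultimately obtain c where c: "lead deglex f = a @ c" "lead deglex g = c @ b"
      unfolding append_eq_append_conv2 by auto
    show ?thesis
    \<comment> \<open>If \<open>a\<close> or \<open>b\<close> is empty, one leading word contains
      the other; then \<open>f = g\<close> and the composition is zero.\<close>
    proof (cases "a = [] \<or> b = []")
      case True
      then have "f = g \<and> a = [] \<and> b = []"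
        using U_Lie2_GS_lead_subword[OF f g, of a "[]"] U_Lie2_GS_lead_subword[OF g f, of "[]" b] c
        by auto
      with ab show ?thesis by (simp add: word_Nil trivial_modulo_0)
    next
      case False
      moreover have "c \<noteq> []" using c a by auto
      ultimately show ?thesis
        using GS_proper_overlap_trivial[OF f g c] ab c by simp
    qed
  next
    assume "inclusion_composition (letters I) deglex f g v h"
    then obtain a b where ab: "lead deglex f = a @ lead deglex g @ b" "h = f - word a * g * word b"
      unfolding inclusion_composition_def by blast
    with U_Lie2_GS_lead_subword[OF f g ab(1)] show ?thesis
      by (simp add: word_Nil trivial_modulo_0)
  qed
qed

theorem mainTheorem1:
  fixes I :: "'i::wellorder set"
  shows "GS_basis_for (letters I) deglex
           (U_Lie2_relators I :: ('i letter list \<Rightarrow>\<^sub>0 'k::field) set) (U_Lie2_GS I)"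
  using U_Lie2_GS_basis U_Lie2_ideal_subset_iff
  unfolding GS_basis_for_def ideal_generated_def by blast

end
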